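(* Let $k\ge 1$ and $n\ge 3$. Let $q\colon UV_n(k)\to M_kVB_n$ be the quotient map onto the multi-virtual braid group. Let $(F1)$ be the family of relations $\rho_i\sigma_{i+1,t}\sigma_{i,t}=\sigma_{i+1,t}\sigma_{i,t}\rho_{i+1}$ and $(F2)$ the family of relations $\rho_{i+1}\sigma_{i,t}\sigma_{i+1,t}=\sigma_{i,t}\sigma_{i+1,t}\rho_i$ (each for all $1\le i\le n-2$, $1\le t\le k$), regarded in $M_kVB_n$ via $q$. Then the two one-forbidden quotients $$M_kVB_n/\langle\!\langle F1\rangle\!\rangle\qquad\text{and}\qquad M_kVB_n/\langle\!\langle F2\rangle\!\rangle$$ are isomorphic groups.
   Context: The universal virtual braid group $UV_n(k)$ is the group with generators $\rho_i,\sigma_{i,t}$ ($1\le i\le n-1$, $1\le t\le k$) and defining relations: (1) $\rho_i^2=1$; $\rho_i\rho_{i+1}\rho_i=\rho_{i+1}\rho_i\rho_{i+1}$ for $1\le i\le n-2$; $\rho_i\rho_j=\rho_j\rho_i$ for $|i-j|\ge 2$; (2) $\sigma_{i,t}\sigma_{j,\ell}=\sigma_{j,\ell}\sigma_{i,t}$ for $|i-j|\ge 2$ and all $1\le t,\ell\le k$; (3) $\sigma_{i,t}\rho_j=\rho_j\sigma_{i,t}$ for $|i-j|\ge 2$; (4) $\rho_i\rho_{i+1}\sigma_{i,t}=\sigma_{i+1,t}\rho_i\rho_{i+1}$ for $1\le i\le n-2$, $1\le t\le k$. The multi-virtual braid group $M_kVB_n$ has generators $\sigma_i$ and $\rho_i^{(\beta)}$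 ($1\le i\le n-1$, $0\le\beta\le k-1$) and is the quotient of $UV_n(k)$ via $q(\rho_i)=\rho_i^{(0)}$, $q(\sigma_{i,t})=\rho_i^{(t)}$ for $1\le t\le k-1$, $q(\sigma_{i,k})=\sigma_i$, obtained by adding to the relations of $UV_n(k)$ (under this identification) the relations $(\rho_i^{(t)})^2=1$ and $\rho_i^{(t)}\rho_{i+1}^{(t)}\rho_i^{(t)}=\rho_{i+1}^{(t)}\rho_i^{(t)}\rho_{i+1}^{(t)}$ for $1\le t\le k-1$, and $\sigma_i\sigma_{i+1}\sigma_i=\sigma_{i+1}\sigma_i\sigma_{i+1}$. For $k=1$, $M_1VB_n=VB_n$ is the virtual braid group. For a family $R$ of relations $u=v$, $\langle\!\langle R\rangle\!\rangle$ denotes the normal closure of the elements $uv^{-1}$. *)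

theory Defs
  imports "HOL-Algebra.Algebra"
begin

section \<open>Normal closures and groups given by generators and relations\<close>

definition normal_closure :: "('a, 'b) monoid_scheme \<Rightarrow> 'a set \<Rightarrow> 'a set"
  where "normal_closure G A = \<Inter>{N. N \<lhd> G \<and> A \<subseteq> N}"

text \<open>A pair \<open>(u, v)\<close> stands for the relation \<open>u = v\<close>.\<close>

definition relation_closure :: "('a, 'b) monoid_scheme \<Rightarrow> ('a \<times> 'a) set \<Rightarrow> 'a set"
  where "relation_closure G R = normal_closure G {u \<otimes>\<^bsub>G\<^esub> inv\<^bsub>G\<^esub> v | u v. (u, v) \<in> R}"

text \<open>
  Words over \<open>S\<close> are lists of letters \<open>(x, b)\<close> with \<open>x \<in> S\<close>; the letter \<open>(x, True)\<close> stands for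
  \<open>x\<close> and \<open>(x, False)\<close> for its inverse.  The free group on \<open>S\<close> consists of the words modulo
  insertion and deletion of adjacent inverse letters.
\<close>

type_synonym 'g word = "('g \<times> bool) list"

definition words :: "'g set \<Rightarrow> 'g word set"
  where "words S = lists (S \<times> UNIV)"

inductive_set free_rel :: "'g set \<Rightarrow> ('g word \<times> 'g word) set" for S
  where
    cancel: "\<lbrakk>u \<in> words S; v \<in> words S; x \<in> S\<rbrakk>
               \<Longrightarrow> (u @ [(x, b), (x, \<not> b)] @ v, u @ v) \<in> free_rel S"
  | refl: "u \<in> words S \<Longrightarrow> (u, u) \<in> free_rel S"
  | sym: "(u, v) \<in> free_rel S \<Longrightarrow> (v, u) \<in> free_rel S"
  | trans: "\<lbrakk>(u, v) \<in> free_rel S; (v, w) \<in> free_rel S\<rbrakk> \<Longrightarrow> (u, w) \<in> free_rel S"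

definition free_class :: "'g set \<Rightarrow> 'g word \<Rightarrow> 'g word set"
  where "free_class S u = free_rel S `` {u}"

definition free_group :: "'g set \<Rightarrow> 'g word set monoid"
  where "free_group S =
    \<lparr>carrier = words S // free_rel S,
     monoid.mult = (\<lambda>A B. \<Union>u\<in>A. \<Union>v\<in>B. free_class S (u @ v)),
     one = free_class S []\<rparr>"

definition free_gen :: "'g set \<Rightarrow> 'g \<Rightarrow> 'g word set"
  where "free_gen S x = free_class S [(x, True)]"


section \<open>Universal virtual braid groups\<close>

datatype uv_gen = RhoGen nat | SigmaGen nat nat

definition uv_gens :: "nat \<Rightarrow> nat \<Rightarrow> uv_gen set"
  where "uv_gens n k = {RhoGen i | i. i \<in> {1..n-1}} \<union> {SigmaGen i t | i t. i \<in> {1..n-1} \<and> t \<in> {1..k}}"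

text \<open>The families of relations below are written in an arbitrary group \<open>G\<close> for given elements
  \<open>r i\<close> and \<open>s i t\<close>, playing the roles of \<open>\<rho>\<^sub>i\<close> and \<open>\<sigma>\<^sub>i\<^sub>,\<^sub>t\<close>.\<close>

definition far :: "nat \<Rightarrow> nat \<Rightarrow> bool"
  where "far i j \<longleftrightarrow> \<bar>int i - int j\<bar> \<ge> 2"

definition uv_relations ::
    "nat \<Rightarrow> nat \<Rightarrow> ('a, 'b) monoid_scheme \<Rightarrow> (nat \<Rightarrow> 'a) \<Rightarrow> (nat \<Rightarrow> nat \<Rightarrow> 'a) \<Rightarrow> ('a \<times> 'a) set"
  where "uv_relations n k G r s =
      {(r i \<otimes> r i, \<one>) | i. i \<in> {1..n-1}}
    \<union> {(r i \<otimes> r (i+1) \<otimes> r i, r (i+1) \<otimes> r i \<otimes> r (i+1)) | i. i \<in> {1..n-2}}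
    \<union> {(r i \<otimes> r j, r j \<otimes> r i) | i j. i \<in> {1..n-1} \<and> j \<in> {1..n-1} \<and> far i j}
    \<union> {(s i t \<otimes> s j l, s j l \<otimes> s i t) | i j t l.
          i \<in> {1..n-1} \<and> j \<in> {1..n-1} \<and> far i j \<and> t \<in> {1..k} \<and> l \<in> {1..k}}
    \<union> {(s i t \<otimes> r j, r j \<otimes> s i t) | i j t.
          i \<in> {1..n-1} \<and> j \<in> {1..n-1} \<and> far i j \<and> t \<in> {1..k}}
    \<union> {(r i \<otimes> r (i+1) \<otimes> s i t, s (i+1) t \<otimes> r i \<otimes> r (i+1)) | i t.
          i \<in> {1..n-2} \<and> t \<in> {1..k}}"
  for G (structure)

definition UV_free :: "nat \<Rightarrow> nat \<Rightarrow> uv_gen word set monoid"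
  where "UV_free n k = free_group (uv_gens n k)"

definition UV_kernel :: "nat \<Rightarrow> nat \<Rightarrow> uv_gen word set set"
  where "UV_kernel n k = relation_closure (UV_free n k)
    (uv_relations n k (UV_free n k)
      (\<lambda>i. free_gen (uv_gens n k) (RhoGen i)) (\<lambda>i t. free_gen (uv_gens n k) (SigmaGen i t)))"

definition UV :: "nat \<Rightarrow> nat \<Rightarrow> uv_gen word set set monoid"
  where "UV n k = UV_free n k Mod UV_kernel n k"

definition uv_rho :: "nat \<Rightarrow> nat \<Rightarrow> nat \<Rightarrow> uv_gen word set set"
  where "uv_rho n k i = UV_kernel n k #>\<^bsub>UV_free n k\<^esub> free_gen (uv_gens n k) (RhoGen i)"

definition uv_sigma :: "nat \<Rightarrow> nat \<Rightarrow> nat \<Rightarrow> nat \<Rightarrow> uv_gen word set set"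
  where "uv_sigma n k i t = UV_kernel n k #>\<^bsub>UV_free n k\<^esub> free_gen (uv_gens n k) (SigmaGen i t)"


section \<open>Multi-virtual braid groups\<close>

text \<open>
  The additional relations of \<open>M\<^sub>kVB\<^sub>n\<close>, pulled back to \<open>UV\<^sub>n(k)\<close> under the identification
  of \<open>\<rho>\<^sub>i\<close> with \<open>\<rho>\<^sub>i\<^sup>(\<^sup>0\<^sup>)\<close>, of \<open>\<sigma>\<^sub>i\<^sub>,\<^sub>t\<close> with \<open>\<rho>\<^sub>i\<^sup>(\<^sup>t\<^sup>)\<close> for \<open>1 \<le> t \<le> k - 1\<close>, and of
  \<open>\<sigma>\<^sub>i\<^sub>,\<^sub>k\<close> with \<open>\<sigma>\<^sub>i\<close>.  Accordingly, only the \<open>\<sigma>\<^sub>i\<^sub>,\<^sub>t\<close> with \<open>t < k\<close> become involutions,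
  while the last family is the braid relation for \<open>\<sigma>\<^sub>i\<close>.
\<close>

definition mvb_relations ::
    "nat \<Rightarrow> nat \<Rightarrow> ('a, 'b) monoid_scheme \<Rightarrow> (nat \<Rightarrow> nat \<Rightarrow> 'a) \<Rightarrow> ('a \<times> 'a) set"
  where "mvb_relations n k G s =
      {(s i t \<otimes> s i t, \<one>) | i t. i \<in> {1..n-1} \<and> t \<in> {1..k-1}}
    \<union> {(s i t \<otimes> s (i+1) t \<otimes> s i t, s (i+1) t \<otimes> s i t \<otimes> s (i+1) t) | i t.
          i \<in> {1..n-2} \<and> t \<in> {1..k-1}}
    \<union> {(s i k \<otimes> s (i+1) k \<otimes> s i k, s (i+1) k \<otimes> s i k \<otimes> s (i+1) k) | i. i \<in> {1..n-2}}"
  for G (structure)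

definition MVB_kernel :: "nat \<Rightarrow> nat \<Rightarrow> uv_gen word set set set"
  where "MVB_kernel n k = relation_closure (UV n k) (mvb_relations n k (UV n k) (uv_sigma n k))"

definition MVB :: "nat \<Rightarrow> nat \<Rightarrow> uv_gen word set set set monoid"
  where "MVB n k = UV n k Mod MVB_kernel n k"

definition mvb_quot :: "nat \<Rightarrow> nat \<Rightarrow> uv_gen word set set \<Rightarrow> uv_gen word set set set"
  where "mvb_quot n k x = MVB_kernel n k #>\<^bsub>UV n k\<^esub> x"


section \<open>Forbidden relations\<close>

definition F1_relations ::
    "nat \<Rightarrow> nat \<Rightarrow> ('a, 'b) monoid_scheme \<Rightarrow> (nat \<Rightarrow> 'a) \<Rightarrow> (nat \<Rightarrow> nat \<Rightarrow> 'a) \<Rightarrow> ('a \<times> 'a) set"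
  where "F1_relations n k G r s =
    {(r i \<otimes> s (i+1) t \<otimes> s i t, s (i+1) t \<otimes> s i t \<otimes> r (i+1)) | i t.
       i \<in> {1..n-2} \<and> t \<in> {1..k}}"
  for G (structure)

definition F2_relations ::
    "nat \<Rightarrow> nat \<Rightarrow> ('a, 'b) monoid_scheme \<Rightarrow> (nat \<Rightarrow> 'a) \<Rightarrow> (nat \<Rightarrow> nat \<Rightarrow> 'a) \<Rightarrow> ('a \<times> 'a) set"
  where "F2_relations n k G r s =
    {(r (i+1) \<otimes> s i t \<otimes> s (i+1) t, s i t \<otimes> s (i+1) t \<otimes> r i) | i t.
       i \<in> {1..n-2} \<and> t \<in> {1..k}}"
  for G (structure)

definition UV_F1 :: "nat \<Rightarrow> nat \<Rightarrow> (uv_gen word set set \<times> uv_gen word set set) set"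
  where "UV_F1 n k = F1_relations n k (UV n k) (uv_rho n k) (uv_sigma n k)"

definition UV_F2 :: "nat \<Rightarrow> nat \<Rightarrow> (uv_gen word set set \<times> uv_gen word set set) set"
  where "UV_F2 n k = F2_relations n k (UV n k) (uv_rho n k) (uv_sigma n k)"


section \<open>Well-formedness\<close>

lemma (in group) normal_closure_normal:
  assumes "A \<subseteq> carrier G"
  shows "normal_closure G A \<lhd> G"
proof -
  have ne: "{N. N \<lhd> G \<and> A \<subseteq> N} \<noteq> {}"
    using assms normal_invI[OF subgroup_self] by auto
  have "subgroup (normal_closure G A) G"
    unfolding normal_closure_def
    by (rule subgroups_Inter[OF _ ne]) (auto simp: normal_imp_subgroup)
  then show ?thesis
    by (rule normal_invI) (auto simp: normal_closure_def normal.inv_op_closed2)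
qed

lemma (in group) relation_closure_normal:
  assumes "R \<subseteq> carrier G \<times> carrier G"
  shows "relation_closure G R \<lhd> G"
  unfolding relation_closure_def using assms by (intro normal_closure_normal) auto

lemma free_rel_words: "(u, v) \<in> free_rel S \<Longrightarrow> u \<in> words S \<and> v \<in> words S"
  by (induction rule: free_rel.induct) (auto simp: words_def)

lemma equiv_free_rel: "equiv (words S) (free_rel S)"
proof (rule equivI)
  show "free_rel S \<subseteq> words S \<times> words S" by (auto dest: free_rel_words)
  show "refl_on (words S) (free_rel S)" by (auto intro!: refl_onI free_rel.refl)
  show "sym (free_rel S)" by (rule symI) (rule free_rel.sym)
  show "trans (free_rel S)" by (rule transI) (rule free_rel.trans)
qed

lemma free_rel_appendL: "(u, v) \<in> free_rel S \<Longrightarrow> w \<in> words S \<Longrightarrow> (w @ u, w @ v) \<in> free_rel S"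
proof (induction rule: free_rel.induct)
  case (cancel u v x b)
  then show ?case
    using free_rel.cancel[of "w @ u" S v x b] by (simp add: words_def)
next
  case (refl u)
  then show ?case by (intro free_rel.refl) (simp add: words_def)
next
  case (sym u v)
  then show ?case by (simp add: free_rel.sym)
next
  case (trans u v z)
  then show ?case using free_rel.trans[of "w @ u" "w @ v" S "w @ z"] by simp
qed

lemma free_rel_appendR: "(u, v) \<in> free_rel S \<Longrightarrow> w \<in> words S \<Longrightarrow> (u @ w, v @ w) \<in> free_rel S"
proof (induction rule: free_rel.induct)
  case (cancel u v x b)
  then show ?case
    using free_rel.cancel[of u S "v @ w" x b] by (simp add: words_def)
next
  case (refl u)
  then show ?case by (intro free_rel.refl) (simp add: words_def)
next
  case (sym u v)
  then show ?case by (simp add: free_rel.sym)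
next
  case (trans u v z)
  then show ?case using free_rel.trans[of "u @ w" "v @ w" S "z @ w"] by simp
qed

lemma free_class_eq_iff:
  "u \<in> words S \<Longrightarrow> v \<in> words S \<Longrightarrow> free_class S u = free_class S v \<longleftrightarrow> (u, v) \<in> free_rel S"
  unfolding free_class_def by (rule eq_equiv_class_iff[OF equiv_free_rel])

lemma append_words: "u \<in> words S \<Longrightarrow> v \<in> words S \<Longrightarrow> u @ v \<in> words S"
  by (simp add: words_def)

lemma carrier_free_group: "carrier (free_group S) = free_class S ` words S"
  by (auto simp: free_group_def quotient_def free_class_def)

lemma one_free_group: "\<one>\<^bsub>free_group S\<^esub> = free_class S []"
  by (simp add: free_group_def)

lemma mult_free_group:
  assumes "u \<in> words S" "v \<in> words S"
  shows "free_class S u \<otimes>\<^bsub>free_group S\<^esub> free_class S v = free_class S (u @ v)"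
proof -
  have eq: "free_class S (u' @ v') = free_class S (u @ v)"
    if "u' \<in> free_class S u" "v' \<in> free_class S v" for u' v'
  proof -
    from that have r: "(u, u') \<in> free_rel S" "(v, v') \<in> free_rel S"
      by (simp_all add: free_class_def)
    then have w: "u' \<in> words S" "v' \<in> words S"
      using free_rel_words by blast+
    have "(u @ v, u' @ v') \<in> free_rel S"
      by (rule free_rel.trans[OF free_rel_appendR[OF r(1) assms(2)] free_rel_appendL[OF r(2) w(1)]])
    then show ?thesis
      using assms w by (simp add: free_class_eq_iff append_words free_rel.sym)
  qed
  have self: "u \<in> free_class S u" "v \<in> free_class S v"
    using assms by (simp_all add: free_class_def free_rel.refl)
  have "(\<Union>u'\<in>free_class S u. \<Union>v'\<in>free_class S v. free_class S (u' @ v'))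
      = (\<Union>u'\<in>free_class S u. \<Union>v'\<in>free_class S v. free_class S (u @ v))"
    by (rule SUP_cong[OF HOL.refl], rule SUP_cong[OF HOL.refl], rule eq)
  also have "\<dots> = free_class S (u @ v)"
    using self by blast
  finally show ?thesis by (simp add: free_group_def)
qed

lemma word_inverse:
  assumes "u \<in> words S"
  shows "(rev (map (\<lambda>(x, b). (x, \<not> b)) u) @ u, []) \<in> free_rel S"
  using assms
proof (induction u)
  case Nil
  then show ?case by (auto intro: free_rel.refl)
next
  case (Cons a u)
  obtain x b where a: "a = (x, b)" by force
  let ?w = "rev (map (\<lambda>(x, b). (x, \<not> b)) u)"
  from Cons.prems a have w: "x \<in> S" "u \<in> words S" "?w \<in> words S" by (auto simp: words_def)
  show ?case
    using free_rel.trans[OF free_rel.cancel[of ?w S u x "\<not> b"] Cons.IH] w a by simp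
qed

lemma group_free_group: "group (free_group S)"
proof (rule groupI)
  fix A B assume "A \<in> carrier (free_group S)" "B \<in> carrier (free_group S)"
  then obtain u v where "A = free_class S u" "B = free_class S v" "u \<in> words S" "v \<in> words S"
    unfolding carrier_free_group by blast
  then show "A \<otimes>\<^bsub>free_group S\<^esub> B \<in> carrier (free_group S)"
    by (simp add: carrier_free_group mult_free_group append_words)
next
  show "\<one>\<^bsub>free_group S\<^esub> \<in> carrier (free_group S)"
    by (simp add: carrier_free_group one_free_group words_def)
next
  fix A B C
  assume "A \<in> carrier (free_group S)" "B \<in> carrier (free_group S)" "C \<in> carrier (free_group S)"
  then obtain u v w where
    e: "A = free_class S u" "B = free_class S v" "C = free_class S w"
    and w: "u \<in> words S" "v \<in> words S" "w \<in> words S"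
    by (auto simp: carrier_free_group)
  moreover from w have "u @ v \<in> words S" "v @ w \<in> words S" by (auto simp: words_def)
  ultimately show "A \<otimes>\<^bsub>free_group S\<^esub> B \<otimes>\<^bsub>free_group S\<^esub> C
      = A \<otimes>\<^bsub>free_group S\<^esub> (B \<otimes>\<^bsub>free_group S\<^esub> C)"
    by (simp add: mult_free_group)
next
  fix A assume "A \<in> carrier (free_group S)"
  then obtain u where u: "A = free_class S u" "u \<in> words S" by (auto simp: carrier_free_group)
  have nil: "[] \<in> words S" by (simp add: words_def)
  show "\<one>\<^bsub>free_group S\<^esub> \<otimes>\<^bsub>free_group S\<^esub> A = A"
    using u nil by (simp add: one_free_group mult_free_group)
  let ?w = "rev (map (\<lambda>(x, b). (x, \<not> b)) u)"
  have w: "?w \<in> words S" using u(2) by (auto simp: words_def)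
  have "?w @ u \<in> words S" using u(2) w by (auto simp: words_def)
  then have "free_class S ?w \<otimes>\<^bsub>free_group S\<^esub> A = \<one>\<^bsub>free_group S\<^esub>"
    using word_inverse[OF u(2)] w u nil by (simp add: one_free_group mult_free_group free_class_eq_iff)
  then show "\<exists>B\<in>carrier (free_group S). B \<otimes>\<^bsub>free_group S\<^esub> A = \<one>\<^bsub>free_group S\<^esub>"
    using w unfolding carrier_free_group by blast
qed

lemma free_gen_closed: "x \<in> S \<Longrightarrow> free_gen S x \<in> carrier (free_group S)"
  unfolding carrier_free_group free_gen_def by (rule imageI) (simp add: words_def)

lemma group_UV_free: "group (UV_free n k)"
  by (simp add: UV_free_def group_free_group)

lemma normal_UV_kernel: "UV_kernel n k \<lhd> UV_free n k"
proof -
  interpret group "UV_free n k" by (rule group_UV_free)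
  have "free_gen (uv_gens n k) (RhoGen i) \<in> carrier (UV_free n k)" if "1 \<le> i" "i \<le> n - 1" for i
    using that by (simp add: UV_free_def free_gen_closed uv_gens_def)
  moreover have "free_gen (uv_gens n k) (SigmaGen i t) \<in> carrier (UV_free n k)"
    if "1 \<le> i" "i \<le> n - 1" "1 \<le> t" "t \<le> k" for i t
    using that by (simp add: UV_free_def free_gen_closed uv_gens_def)
  ultimately show ?thesis
    unfolding UV_kernel_def by (intro relation_closure_normal) (auto simp: uv_relations_def)
qed

lemma group_UV: "group (UV n k)"
  unfolding UV_def by (rule normal.factorgroup_is_group[OF normal_UV_kernel])

lemma uv_rho_closed:
  assumes "i \<in> {1..n-1}"
  shows "uv_rho n k i \<in> carrier (UV n k)"
proof -
  have "free_gen (uv_gens n k) (RhoGen i) \<in> carrier (UV_free n k)"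
    using assms by (simp add: UV_free_def free_gen_closed uv_gens_def)
  then show ?thesis
    unfolding UV_def uv_rho_def
    by (rule hom_in_carrier[OF normal.r_coset_hom_Mod[OF normal_UV_kernel]])
qed

lemma uv_sigma_closed:
  assumes "i \<in> {1..n-1}" "t \<in> {1..k}"
  shows "uv_sigma n k i t \<in> carrier (UV n k)"
proof -
  have "free_gen (uv_gens n k) (SigmaGen i t) \<in> carrier (UV_free n k)"
    using assms by (simp add: UV_free_def free_gen_closed uv_gens_def)
  then show ?thesis
    unfolding UV_def uv_sigma_def
    by (rule hom_in_carrier[OF normal.r_coset_hom_Mod[OF normal_UV_kernel]])
qed

lemma normal_MVB_kernel:
  assumes "k \<ge> 1"
  shows "MVB_kernel n k \<lhd> UV n k"
proof -
  interpret group "UV n k" by (rule group_UV)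
  have s: "uv_sigma n k i t \<in> carrier (UV n k)" if "1 \<le> i" "i \<le> n - 1" "1 \<le> t" "t \<le> k" for i t
    using that by (simp add: uv_sigma_closed)
  show ?thesis
    unfolding MVB_kernel_def
    by (intro relation_closure_normal) (use assms in \<open>auto simp: mvb_relations_def s\<close>)
qed

lemma group_MVB: "k \<ge> 1 \<Longrightarrow> group (MVB n k)"
  unfolding MVB_def by (rule normal.factorgroup_is_group[OF normal_MVB_kernel])

lemma mvb_quot_hom:
  assumes "k \<ge> 1"
  shows "mvb_quot n k \<in> hom (UV n k) (MVB n k)"
proof -
  have "mvb_quot n k = (\<lambda>x. MVB_kernel n k #>\<^bsub>UV n k\<^esub> x)"
    by (rule ext) (simp add: mvb_quot_def)
  then show ?thesis
    using normal.r_coset_hom_Mod[OF normal_MVB_kernel[OF assms]] by (simp add: MVB_def)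
qed

lemma UV_F_closed:
  "UV_F1 n k \<subseteq> carrier (UV n k) \<times> carrier (UV n k)"
  "UV_F2 n k \<subseteq> carrier (UV n k) \<times> carrier (UV n k)"
proof -
  interpret group "UV n k" by (rule group_UV)
  have s: "uv_sigma n k i t \<in> carrier (UV n k)" if "1 \<le> i" "i \<le> n - 1" "1 \<le> t" "t \<le> k" for i t
    using that by (simp add: uv_sigma_closed)
  have r: "uv_rho n k i \<in> carrier (UV n k)" if "1 \<le> i" "i \<le> n - 1" for i
    using that by (simp add: uv_rho_closed)
  show "UV_F1 n k \<subseteq> carrier (UV n k) \<times> carrier (UV n k)"
    "UV_F2 n k \<subseteq> carrier (UV n k) \<times> carrier (UV n k)"
    by (auto simp: UV_F1_def UV_F2_def F1_relations_def F2_relations_def s r)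
qed

end

theory Submission
  imports Defs
begin

text \<open>
  Both quotients are exchanged by reversing the order of the strands, that is, by
  \<open>\<rho>\<^sub>i \<mapsto> \<rho>\<^sub>n\<^sub>-\<^sub>i\<close> and \<open>\<sigma>\<^sub>i\<^sub>,\<^sub>t \<mapsto> \<sigma>\<^sub>n\<^sub>-\<^sub>i\<^sub>,\<^sub>t\<close>.  The substitution turns a relation between the
  generators of indices \<open>i\<close> and \<open>i + 1\<close> into one between those of indices \<open>j + 1\<close> and \<open>j\<close>, where
  \<open>j = n - i - 1\<close>.  The braid relations and the relations between distant generators are
  symmetric under this exchange of roles.  The mixed relation \<open>\<rho>\<^sub>i\<rho>\<^sub>i\<^sub>+\<^sub>1\<sigma>\<^sub>i\<^sub>,\<^sub>t = \<sigma>\<^sub>i\<^sub>+\<^sub>1\<^sub>,\<^sub>t\<rho>\<^sub>i\<rho>\<^sub>i\<^sub>+\<^sub>1\<close>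
  is not literally symmetric, but its mirror image follows from it by multiplying with
  \<open>\<rho>\<^sub>i\<^sub>+\<^sub>1\<rho>\<^sub>i = (\<rho>\<^sub>i\<rho>\<^sub>i\<^sub>+\<^sub>1)\<^sup>-\<^sup>1\<close> on both sides (\<open>mixed_relation_reverse\<close>).  Finally the mirror image of
  a relation of the family F1 is exactly a relation of the family F2.

  Hence the reversed generators of each quotient satisfy the defining relations of the other
  (\<open>reverse\<close>, \<open>reverse_forbidden\<close>), and the universal property of the presentation gives
  homomorphisms in both directions (\<open>hom_from_MVB_quotient\<close>).  Their composites fix the
  generators, because \<open>n - (n - i) = i\<close>, and so are identities (\<open>MVB_quotient_hom_eqI\<close>).

  The universal property is assembled along the tower free group, \<open>UV\<^sub>n(k)\<close>, \<open>M\<^sub>kVB\<^sub>n\<close>,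
  quotient: each step divides by the normal closure of relations that a homomorphism to the
  target group respects.
\<close>

section \<open>Quotients by relations\<close>

lemma (in group) relator_in_relation_closure:
  "(u, v) \<in> R \<Longrightarrow> u \<otimes> inv v \<in> relation_closure G R"
  unfolding relation_closure_def normal_closure_def by blast

lemma (in group) relation_closure_coset_eq:
  assumes R: "R \<subseteq> carrier G \<times> carrier G" and uv: "(u, v) \<in> R"
  shows "relation_closure G R #> u = relation_closure G R #> v"
proof -
  have c: "u \<in> carrier G" "v \<in> carrier G" using R uv by auto
  have "u = u \<otimes> inv v \<otimes> v" using c by (simp add: m_assoc)
  with relator_in_relation_closure[OF uv]
  have "u \<in> relation_closure G R #> v"
    unfolding r_coset_def by blast
  then show ?thesis
    using repr_independence c normal_imp_subgroup[OF relation_closure_normal[OF R]] by metis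
qed

text \<open>The kernel of \<open>h\<close> is one of the normal subgroups over which the normal closure is the
  intersection.\<close>

lemma (in group_hom) hom_from_relation_quotient:
  assumes R: "R \<subseteq> carrier G \<times> carrier G" and h: "map_prod h h ` R \<subseteq> Id"
  obtains g where "g \<in> hom (G Mod relation_closure G R) H"
    "\<And>x. x \<in> carrier G \<Longrightarrow> g (relation_closure G R #> x) = h x"
proof -
  have "u \<otimes> inv v \<in> kernel G H h" if "(u, v) \<in> R" for u v
  proof -
    have "h u = h v" using h that by force
    moreover have "u \<in> carrier G" "v \<in> carrier G" using R that by auto
    ultimately show ?thesis by (simp add: kernel_def)
  qed
  then have "relation_closure G R \<subseteq> kernel G H h"
    unfolding relation_closure_def normal_closure_def using normal_kernel by blast
  then show thesis
    using FactGroup_universal_kernel[OF G.relation_closure_normal[OF R]] that by blast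
qed

lemma (in group) coset_group_hom:
  assumes "N \<lhd> G"
  shows "group_hom G (G Mod N) (\<lambda>x. N #> x)"
  by (intro group_hom.intro group_hom_axioms.intro is_group
      normal.factorgroup_is_group[OF assms] normal.r_coset_hom_Mod[OF assms])

lemma (in group) map_prod_coset_relations:
  assumes "R \<subseteq> carrier G \<times> carrier G"
  shows "map_prod (\<lambda>x. relation_closure G R #> x) (\<lambda>x. relation_closure G R #> x) ` R \<subseteq> Id"
  using relation_closure_coset_eq[OF assms] by auto

section \<open>Free groups\<close>

context group
begin

definition word_value :: "('g \<Rightarrow> 'a) \<Rightarrow> 'g word \<Rightarrow> 'a"
  where "word_value \<phi> w = foldr (\<lambda>(x, b) a. (if b then \<phi> x else inv (\<phi> x)) \<otimes> a) w \<one>"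

lemma word_value_simps [simp]:
  "word_value \<phi> [] = \<one>"
  "word_value \<phi> ((x, b) # w) = (if b then \<phi> x else inv (\<phi> x)) \<otimes> word_value \<phi> w"
  by (simp_all add: word_value_def)

lemma word_value_closed:
  assumes "\<phi> \<in> S \<rightarrow> carrier G" "w \<in> words S"
  shows "word_value \<phi> w \<in> carrier G"
  using assms(2) by (induction w) (use assms(1) in \<open>auto simp: words_def Pi_iff\<close>)

lemma word_value_append:
  assumes \<phi>: "\<phi> \<in> S \<rightarrow> carrier G" and "u \<in> words S" "v \<in> words S"
  shows "word_value \<phi> (u @ v) = word_value \<phi> u \<otimes> word_value \<phi> v"
  using assms(2)
proof (induction u)
  case Nil
  then show ?case using word_value_closed[OF \<phi> assms(3)] by simp
next
  case (Cons a u)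
  obtain x b where a: "a = (x, b)" by force
  from Cons.prems a have u: "u \<in> words S" and x: "\<phi> x \<in> carrier G"
    using \<phi> by (auto simp: words_def)
  show ?case
    using Cons.IH[OF u] x word_value_closed[OF \<phi> u] word_value_closed[OF \<phi> assms(3)]
    by (simp add: a m_assoc)
qed

lemma word_value_cong:
  assumes \<phi>: "\<phi> \<in> S \<rightarrow> carrier G"
  shows "(u, v) \<in> free_rel S \<Longrightarrow> word_value \<phi> u = word_value \<phi> v"
proof (induction rule: free_rel.induct)
  case (cancel u v x b)
  have x: "\<phi> x \<in> carrier G" using \<phi> cancel by auto
  have "[(x, b), (x, \<not> b)] @ v \<in> words S" using cancel by (auto simp: words_def)
  moreover have "word_value \<phi> ([(x, b), (x, \<not> b)] @ v) = word_value \<phi> v"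
    using x word_value_closed[OF \<phi> \<open>v \<in> words S\<close>] by (simp add: m_assoc[symmetric])
  ultimately show ?case
    using word_value_append[OF \<phi>] cancel by simp
qed simp_all

lemma hom_from_free_group:
  assumes \<phi>: "\<phi> \<in> S \<rightarrow> carrier G"
  obtains h where "h \<in> hom (free_group S) G" "\<And>x. x \<in> S \<Longrightarrow> h (free_gen S x) = \<phi> x"
proof
  \<comment> \<open>Any representative of the class will do, since \<open>word_value\<close> respects the free relation.\<close>
  let ?h = "\<lambda>A. word_value \<phi> (SOME u. u \<in> A)"
  have h: "?h (free_class S u) = word_value \<phi> u" if u: "u \<in> words S" for u
  proof -
    have "u \<in> free_class S u" using u by (simp add: free_class_def free_rel.refl)
    then have "(SOME v. v \<in> free_class S u) \<in> free_class S u" by (rule someI)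
    then have "(u, SOME v. v \<in> free_class S u) \<in> free_rel S" by (simp add: free_class_def)
    then show ?thesis using word_value_cong[OF \<phi>] by simp
  qed
  show "?h \<in> hom (free_group S) G"
    by (rule homI)
      (auto simp: carrier_free_group h mult_free_group append_words
        word_value_closed[OF \<phi>] word_value_append[OF \<phi>])
  show "?h (free_gen S x) = \<phi> x" if "x \<in> S" for x
    using that \<phi> h[of "[(x, True)]"] by (simp add: free_gen_def words_def Pi_iff)
qed

end

text \<open>Together with \<open>free_gen\<close> this covers all one-letter words, of which every element is a
  product.\<close>

lemma inv_free_gen:
  assumes "x \<in> S"
  shows "inv\<^bsub>free_group S\<^esub> (free_gen S x) = free_class S [(x, False)]"
proof -
  interpret group "free_group S" by (rule group_free_group)
  have w: "[(x, b)] \<in> words S" "[(x, b), (x, c)] \<in> words S" "[] \<in> words S" for b c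
    using assms by (auto simp: words_def)
  have "free_class S [(x, False)] \<otimes>\<^bsub>free_group S\<^esub> free_gen S x = \<one>\<^bsub>free_group S\<^esub>"
    using w free_rel.cancel[of "[]" S "[]" x False] assms
    by (simp add: free_gen_def mult_free_group one_free_group free_class_eq_iff)
  moreover have "free_class S [(x, False)] \<in> carrier (free_group S)"
    using w by (auto simp: carrier_free_group)
  ultimately show ?thesis
    using inv_equality free_gen_closed[OF assms] by blast
qed

lemma free_group_hom_eqI:
  assumes "group H" "f \<in> hom (free_group S) H" "g \<in> hom (free_group S) H"
    and eq: "\<And>x. x \<in> S \<Longrightarrow> f (free_gen S x) = g (free_gen S x)"
    and A: "A \<in> carrier (free_group S)"
  shows "f A = g A"
proof -
  interpret f: group_hom "free_group S" H f
    by (intro group_hom.intro group_hom_axioms.intro group_free_group assms)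
  interpret g: group_hom "free_group S" H g
    by (intro group_hom.intro group_hom_axioms.intro group_free_group assms)
  have "f (free_class S u) = g (free_class S u)" if "u \<in> words S" for u
    using that
  proof (induction u)
    case Nil
    then show ?case using f.hom_one g.hom_one by (simp add: one_free_group)
  next
    case (Cons a u)
    obtain x b where a: "a = (x, b)" by force
    from Cons.prems a have u: "u \<in> words S" and x: "x \<in> S" and xb: "[(x, b)] \<in> words S"
      by (auto simp: words_def)
    have "f (free_class S [(x, b)]) = g (free_class S [(x, b)])"
      using eq[OF x] f.hom_inv[OF free_gen_closed[OF x]] g.hom_inv[OF free_gen_closed[OF x]]
      by (cases b) (simp_all add: inv_free_gen[OF x] free_gen_def[symmetric])
    moreover have "free_class S (a # u) = free_class S [(x, b)] \<otimes>\<^bsub>free_group S\<^esub> free_class S u"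
      using mult_free_group[OF xb u] a by simp
    moreover have "free_class S [(x, b)] \<in> carrier (free_group S)"
      "free_class S u \<in> carrier (free_group S)"
      using xb u by (auto simp: carrier_free_group)
    ultimately show ?case using Cons.IH[OF u] f.hom_mult g.hom_mult by simp
  qed
  with A show ?thesis by (auto simp: carrier_free_group)
qed

section \<open>Families of relations under homomorphisms\<close>

lemma map_prod_collect1:
  "map_prod h h ` {(f i, g i) | i. P i} = {(h (f i), h (g i)) | i. P i}" by force
lemma map_prod_collect2:
  "map_prod h h ` {(f i j, g i j) | i j. P i j} = {(h (f i j), h (g i j)) | i j. P i j}" by force
lemma map_prod_collect4:
  "map_prod h h ` {(f i j a b, g i j a b) | i j a b. P i j a b}
   = {(h (f i j a b), h (g i j a b)) | i j a b. P i j a b}" by force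
lemma map_prod_collect3:
  "map_prod h h ` {(f i j a, g i j a) | i j a. P i j a}
   = {(h (f i j a), h (g i j a)) | i j a. P i j a}" by force

text \<open>
  Homomorphisms carry each family of relations to the same family for the images of the
  generators.  Read from left to right this shows that a homomorphism respects the relations as
  soon as its values on the generators satisfy them; read from right to left it shows that the
  relations hold in the quotient by them.
\<close>

lemma (in group_hom) uv_relations_image:
  assumes r: "\<And>i. i \<in> {1..n-1} \<Longrightarrow> r i \<in> carrier G"
    and s: "\<And>i t. i \<in> {1..n-1} \<Longrightarrow> t \<in> {1..k} \<Longrightarrow> s i t \<in> carrier G"
    and hr: "\<And>i. i \<in> {1..n-1} \<Longrightarrow> h (r i) = r' i"
    and hs: "\<And>i t. i \<in> {1..n-1} \<Longrightarrow> t \<in> {1..k} \<Longrightarrow> h (s i t) = s' i t"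
  shows "map_prod h h ` uv_relations n k G r s = uv_relations n k H r' s'"
proof -
  have idx: "i \<in> {1..n-1}" "i + 1 \<in> {1..n-1}" if "i \<in> {1..n-2}" for i using that by auto
  show ?thesis
    unfolding uv_relations_def image_Un map_prod_collect1 map_prod_collect2 map_prod_collect3 map_prod_collect4
    by (simp only: idx r s hr hs hom_mult hom_one G.m_closed cong: rev_conj_cong)
qed

lemma (in group_hom) mvb_relations_image:
  assumes k: "k \<ge> 1"
    and s: "\<And>i t. i \<in> {1..n-1} \<Longrightarrow> t \<in> {1..k} \<Longrightarrow> s i t \<in> carrier G"
    and hs: "\<And>i t. i \<in> {1..n-1} \<Longrightarrow> t \<in> {1..k} \<Longrightarrow> h (s i t) = s' i t"
  shows "map_prod h h ` mvb_relations n k G s = mvb_relations n k H s'"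
proof -
  have idx: "i \<in> {1..n-1}" "i + 1 \<in> {1..n-1}" if "i \<in> {1..n-2}" for i using that by auto
  have idx': "t \<in> {1..k}" if "t \<in> {1..k-1}" for t using that by auto
  have "k \<in> {1..k}" using k by simp
  then show ?thesis
    unfolding mvb_relations_def image_Un map_prod_collect1 map_prod_collect2
    by (simp only: idx idx' s hs hom_mult hom_one G.m_closed cong: rev_conj_cong)
qed

lemma (in group_hom) forbidden_relations_image:
  assumes r: "\<And>i. i \<in> {1..n-1} \<Longrightarrow> r i \<in> carrier G"
    and s: "\<And>i t. i \<in> {1..n-1} \<Longrightarrow> t \<in> {1..k} \<Longrightarrow> s i t \<in> carrier G"
    and hr: "\<And>i. i \<in> {1..n-1} \<Longrightarrow> h (r i) = r' i"
    and hs: "\<And>i t. i \<in> {1..n-1} \<Longrightarrow> t \<in> {1..k} \<Longrightarrow> h (s i t) = s' i t"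
  shows "map_prod h h ` F1_relations n k G r s = F1_relations n k H r' s'"
    and "map_prod h h ` F2_relations n k G r s = F2_relations n k H r' s'"
proof -
  have idx: "i \<in> {1..n-1}" "i + 1 \<in> {1..n-1}" if "i \<in> {1..n-2}" for i using that by auto
  show "map_prod h h ` F1_relations n k G r s = F1_relations n k H r' s'"
    "map_prod h h ` F2_relations n k G r s = F2_relations n k H r' s'"
    unfolding F1_relations_def F2_relations_def map_prod_collect2
    by (simp_all only: idx r s hr hs hom_mult G.m_closed cong: rev_conj_cong)
qed

text \<open>The data that define a homomorphism from \<open>M\<^sub>kVB\<^sub>n\<close> into \<open>G\<close>.\<close>

locale multi_virtual_family = group G for G (structure) +
  fixes n k :: nat and r :: "nat \<Rightarrow> 'a" and s :: "nat \<Rightarrow> nat \<Rightarrow> 'a"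
  assumes k: "k \<ge> 1"
    and r_closed: "i \<in> {1..n-1} \<Longrightarrow> r i \<in> carrier G"
    and s_closed: "i \<in> {1..n-1} \<Longrightarrow> t \<in> {1..k} \<Longrightarrow> s i t \<in> carrier G"
    and uv_relations: "uv_relations n k G r s \<subseteq> Id"
    and mvb_relations: "mvb_relations n k G s \<subseteq> Id"

section \<open>The universal property of the universal virtual braid group\<close>

lemma free_gens_closed:
  "i \<in> {1..n-1} \<Longrightarrow> free_gen (uv_gens n k) (RhoGen i) \<in> carrier (UV_free n k)"
  "i \<in> {1..n-1} \<Longrightarrow> t \<in> {1..k} \<Longrightarrow> free_gen (uv_gens n k) (SigmaGen i t) \<in> carrier (UV_free n k)"
  by (simp_all add: UV_free_def free_gen_closed uv_gens_def)

lemma uv_relations_closed: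
  assumes "group G"
    and r: "\<And>i. i \<in> {1..n-1} \<Longrightarrow> r i \<in> carrier G"
    and s: "\<And>i t. i \<in> {1..n-1} \<Longrightarrow> t \<in> {1..k} \<Longrightarrow> s i t \<in> carrier G"
  shows "uv_relations n k G r s \<subseteq> carrier G \<times> carrier G"
proof -
  interpret group G by fact
  from r s show ?thesis by (auto simp: uv_relations_def)
qed

lemma mvb_relations_closed:
  assumes "group G" and k: "k \<ge> 1"
    and s: "\<And>i t. i \<in> {1..n-1} \<Longrightarrow> t \<in> {1..k} \<Longrightarrow> s i t \<in> carrier G"
  shows "mvb_relations n k G s \<subseteq> carrier G \<times> carrier G"
proof -
  interpret group G by fact
  from k s show ?thesis by (auto simp: mvb_relations_def)
qed

lemma UV_coset_group_hom: "group_hom (UV_free n k) (UV n k) (\<lambda>x. UV_kernel n k #>\<^bsub>UV_free n k\<^esub> x)"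
  unfolding UV_def by (rule group.coset_group_hom[OF group_UV_free normal_UV_kernel])

lemma UV_satisfies_uv_relations: "uv_relations n k (UV n k) (uv_rho n k) (uv_sigma n k) \<subseteq> Id"
proof -
  interpret F: group "UV_free n k" by (rule group_UV_free)
  interpret group_hom "UV_free n k" "UV n k" "\<lambda>x. UV_kernel n k #>\<^bsub>UV_free n k\<^esub> x"
    by (rule UV_coset_group_hom)
  let ?r = "\<lambda>i. free_gen (uv_gens n k) (RhoGen i)"
  let ?s = "\<lambda>i t. free_gen (uv_gens n k) (SigmaGen i t)"
  have "uv_relations n k (UV n k) (uv_rho n k) (uv_sigma n k)
      = map_prod (\<lambda>x. UV_kernel n k #>\<^bsub>UV_free n k\<^esub> x) (\<lambda>x. UV_kernel n k #>\<^bsub>UV_free n k\<^esub> x) `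
          uv_relations n k (UV_free n k) ?r ?s"
    by (rule uv_relations_image[symmetric]) (simp_all add: free_gens_closed uv_rho_def uv_sigma_def)
  also have "\<dots> \<subseteq> Id"
    unfolding UV_kernel_def
    by (intro F.map_prod_coset_relations uv_relations_closed group_UV_free free_gens_closed)
  finally show ?thesis .
qed

lemma hom_from_UV:
  assumes H: "group H"
    and r: "\<And>i. i \<in> {1..n-1} \<Longrightarrow> r i \<in> carrier H"
    and s: "\<And>i t. i \<in> {1..n-1} \<Longrightarrow> t \<in> {1..k} \<Longrightarrow> s i t \<in> carrier H"
    and rel: "uv_relations n k H r s \<subseteq> Id"
  obtains h where "h \<in> hom (UV n k) H"
    "\<And>i. i \<in> {1..n-1} \<Longrightarrow> h (uv_rho n k i) = r i"
    "\<And>i t. i \<in> {1..n-1} \<Longrightarrow> t \<in> {1..k} \<Longrightarrow> h (uv_sigma n k i t) = s i t"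
proof -
  let ?\<phi> = "case_uv_gen r s"
  have "?\<phi> \<in> uv_gens n k \<rightarrow> carrier H" using r s by (auto simp: uv_gens_def)
  then obtain f where f: "f \<in> hom (UV_free n k) H"
    and f_gen: "\<And>x. x \<in> uv_gens n k \<Longrightarrow> f (free_gen (uv_gens n k) x) = ?\<phi> x"
    unfolding UV_free_def using group.hom_from_free_group[OF H] by metis
  interpret f: group_hom "UV_free n k" H f
    by (intro group_hom.intro group_hom_axioms.intro group_UV_free H f)
  have fr: "f (free_gen (uv_gens n k) (RhoGen i)) = r i" if "i \<in> {1..n-1}" for i
    using f_gen[of "RhoGen i"] that by (simp add: uv_gens_def)
  have fs: "f (free_gen (uv_gens n k) (SigmaGen i t)) = s i t"
    if "i \<in> {1..n-1}" "t \<in> {1..k}" for i t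
    using f_gen[of "SigmaGen i t"] that by (simp add: uv_gens_def)
  have rel_f: "map_prod f f ` uv_relations n k (UV_free n k) (\<lambda>i. free_gen (uv_gens n k) (RhoGen i))
      (\<lambda>i t. free_gen (uv_gens n k) (SigmaGen i t)) \<subseteq> Id"
    by (subst f.uv_relations_image[of n _ k _ r s]) (use rel in \<open>simp_all add: free_gens_closed fr fs\<close>)
  have rel_closed: "uv_relations n k (UV_free n k) (\<lambda>i. free_gen (uv_gens n k) (RhoGen i))
      (\<lambda>i t. free_gen (uv_gens n k) (SigmaGen i t)) \<subseteq> carrier (UV_free n k) \<times> carrier (UV_free n k)"
    by (intro uv_relations_closed group_UV_free free_gens_closed)
  obtain h where h: "h \<in> hom (UV n k) H"
    and hf: "\<And>x. x \<in> carrier (UV_free n k) \<Longrightarrow> h (UV_kernel n k #>\<^bsub>UV_free n k\<^esub> x) = f x"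
    by (rule f.hom_from_relation_quotient[OF rel_closed rel_f, folded UV_kernel_def, folded UV_def])
      (rule that)
  show thesis
    by (rule that[OF h])
      (simp_all add: uv_rho_def uv_sigma_def hf fr fs free_gens_closed)
qed

lemma UV_hom_eqI:
  assumes H: "group H" and f: "f \<in> hom (UV n k) H" and g: "g \<in> hom (UV n k) H"
    and r: "\<And>i. i \<in> {1..n-1} \<Longrightarrow> f (uv_rho n k i) = g (uv_rho n k i)"
    and s: "\<And>i t. i \<in> {1..n-1} \<Longrightarrow> t \<in> {1..k} \<Longrightarrow> f (uv_sigma n k i t) = g (uv_sigma n k i t)"
    and x: "x \<in> carrier (UV n k)"
  shows "f x = g x"
proof -
  let ?p = "\<lambda>x. UV_kernel n k #>\<^bsub>UV_free n k\<^esub> x"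
  have p: "?p \<in> hom (UV_free n k) (UV n k)"
    using UV_coset_group_hom group_hom.homh by blast
  from x obtain y where y: "y \<in> carrier (UV_free n k)" "x = ?p y"
    by (auto simp: UV_def carrier_FactGroup)
  have "(f \<circ> ?p) (free_gen (uv_gens n k) z) = (g \<circ> ?p) (free_gen (uv_gens n k) z)"
    if "z \<in> uv_gens n k" for z
    using that r s unfolding uv_gens_def[of n k] uv_rho_def uv_sigma_def by auto
  then have "(f \<circ> ?p) y = (g \<circ> ?p) y"
    by (rule free_group_hom_eqI[OF H hom_compose[OF p f, unfolded UV_free_def]
          hom_compose[OF p g, unfolded UV_free_def], folded UV_free_def])
      (use y in simp_all)
  then show ?thesis using y by simp
qed

section \<open>Quotients of the multi-virtual braid group\<close>

text \<open>Relations are taken in \<open>UV\<^sub>n(k)\<close>, so that both forbidden quotients, and the canonical maps from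
  \<open>UV\<^sub>n(k)\<close> onto them, are instances with \<open>R\<close> equal to \<open>UV_F1 n k\<close> and \<open>UV_F2 n k\<close>.\<close>

definition MVB_quotient ::
    "nat \<Rightarrow> nat \<Rightarrow> (uv_gen word set set \<times> uv_gen word set set) set \<Rightarrow> uv_gen word set set set set monoid"
  where "MVB_quotient n k R =
    MVB n k Mod relation_closure (MVB n k) (map_prod (mvb_quot n k) (mvb_quot n k) ` R)"

definition MVB_quotient_proj ::
    "nat \<Rightarrow> nat \<Rightarrow> (uv_gen word set set \<times> uv_gen word set set) set
      \<Rightarrow> uv_gen word set set \<Rightarrow> uv_gen word set set set set"
  where "MVB_quotient_proj n k R x =
    relation_closure (MVB n k) (map_prod (mvb_quot n k) (mvb_quot n k) ` R) #>\<^bsub>MVB n k\<^esub> mvb_quot n k x"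

context
  fixes n k :: nat and R :: "(uv_gen word set set \<times> uv_gen word set set) set"
  assumes k: "k \<ge> 1" and R: "R \<subseteq> carrier (UV n k) \<times> carrier (UV n k)"
begin

interpretation q: group_hom "UV n k" "MVB n k" "mvb_quot n k"
  by (intro group_hom.intro group_hom_axioms.intro group_UV group_MVB mvb_quot_hom k)

lemma mvb_quot_relations_closed:
  "map_prod (mvb_quot n k) (mvb_quot n k) ` R \<subseteq> carrier (MVB n k) \<times> carrier (MVB n k)"
  using R by auto

lemma MVB_quotient_coset_group_hom:
  "group_hom (MVB n k) (MVB_quotient n k R)
    (\<lambda>x. relation_closure (MVB n k) (map_prod (mvb_quot n k) (mvb_quot n k) ` R) #>\<^bsub>MVB n k\<^esub> x)"
  unfolding MVB_quotient_def
  by (intro q.H.coset_group_hom q.H.relation_closure_normal mvb_quot_relations_closed)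

lemma group_hom_MVB_quotient_proj:
  "group_hom (UV n k) (MVB_quotient n k R) (MVB_quotient_proj n k R)"
proof -
  interpret c: group_hom "MVB n k" "MVB_quotient n k R"
    "\<lambda>x. relation_closure (MVB n k) (map_prod (mvb_quot n k) (mvb_quot n k) ` R) #>\<^bsub>MVB n k\<^esub> x"
    by (rule MVB_quotient_coset_group_hom)
  show ?thesis
    using hom_compose[OF q.homh c.homh]
    by (intro group_hom.intro group_hom_axioms.intro group_UV c.H.is_group)
      (simp add: MVB_quotient_proj_def[abs_def] comp_def)
qed

interpretation p: group_hom "UV n k" "MVB_quotient n k R" "MVB_quotient_proj n k R"
  by (rule group_hom_MVB_quotient_proj)

lemma MVB_quotient_satisfies: "map_prod (MVB_quotient_proj n k R) (MVB_quotient_proj n k R) ` R \<subseteq> Id"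
  using q.H.map_prod_coset_relations[OF mvb_quot_relations_closed]
  by (force simp: MVB_quotient_proj_def)

lemma MVB_quotient_family:
  "multi_virtual_family (MVB_quotient n k R) n k
    (\<lambda>i. MVB_quotient_proj n k R (uv_rho n k i)) (\<lambda>i t. MVB_quotient_proj n k R (uv_sigma n k i t))"
proof -
  let ?p = "MVB_quotient_proj n k R"
  have "uv_relations n k (MVB_quotient n k R) (\<lambda>i. ?p (uv_rho n k i)) (\<lambda>i t. ?p (uv_sigma n k i t))
      = map_prod ?p ?p ` uv_relations n k (UV n k) (uv_rho n k) (uv_sigma n k)"
    by (rule p.uv_relations_image[symmetric]) (simp_all add: uv_rho_closed uv_sigma_closed)
  also have "\<dots> \<subseteq> Id" using UV_satisfies_uv_relations by force
  finally have uv: "uv_relations n k (MVB_quotient n k R)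
    (\<lambda>i. ?p (uv_rho n k i)) (\<lambda>i t. ?p (uv_sigma n k i t)) \<subseteq> Id" .
  have "map_prod (mvb_quot n k) (mvb_quot n k) ` mvb_relations n k (UV n k) (uv_sigma n k) \<subseteq> Id"
    using q.G.map_prod_coset_relations[OF mvb_relations_closed[OF group_UV k uv_sigma_closed]]
    by (force simp: mvb_quot_def MVB_kernel_def)
  then have "map_prod ?p ?p ` mvb_relations n k (UV n k) (uv_sigma n k) \<subseteq> Id"
    by (force simp: MVB_quotient_proj_def)
  moreover have "map_prod ?p ?p ` mvb_relations n k (UV n k) (uv_sigma n k)
      = mvb_relations n k (MVB_quotient n k R) (\<lambda>i t. ?p (uv_sigma n k i t))"
    by (rule p.mvb_relations_image[OF k]) (simp_all add: uv_sigma_closed)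
  ultimately have "mvb_relations n k (MVB_quotient n k R) (\<lambda>i t. ?p (uv_sigma n k i t)) \<subseteq> Id"
    by simp
  with uv show ?thesis
    by unfold_locales (simp_all add: k uv_rho_closed uv_sigma_closed del: One_nat_def)
qed

text \<open>The universal property of the presentation of the quotient.  The hypothesis \<open>kill\<close> asks that \<open>R\<close>
  hold for \<open>r\<close> and \<open>s\<close>: as \<open>R\<close> is an arbitrary set of pairs in \<open>UV\<^sub>n(k)\<close>, this is expressed through
  the homomorphism on \<open>UV\<^sub>n(k)\<close> that \<open>r\<close> and \<open>s\<close> determine.\<close>

lemma hom_from_MVB_quotient:
  assumes "multi_virtual_family H n k r s"
    and kill: "\<And>h. \<lbrakk>group_hom (UV n k) H h; \<And>i. i \<in> {1..n-1} \<Longrightarrow> h (uv_rho n k i) = r i;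
        \<And>i t. i \<in> {1..n-1} \<Longrightarrow> t \<in> {1..k} \<Longrightarrow> h (uv_sigma n k i t) = s i t\<rbrakk>
      \<Longrightarrow> map_prod h h ` R \<subseteq> Id"
  obtains h where "h \<in> hom (MVB_quotient n k R) H"
    "\<And>i. i \<in> {1..n-1} \<Longrightarrow> h (MVB_quotient_proj n k R (uv_rho n k i)) = r i"
    "\<And>i t. i \<in> {1..n-1} \<Longrightarrow> t \<in> {1..k}
      \<Longrightarrow> h (MVB_quotient_proj n k R (uv_sigma n k i t)) = s i t"
proof -
  interpret H: multi_virtual_family H n k r s by fact
  obtain f where f: "f \<in> hom (UV n k) H"
    and fr: "\<And>i. i \<in> {1..n-1} \<Longrightarrow> f (uv_rho n k i) = r i"
    and fs: "\<And>i t. i \<in> {1..n-1} \<Longrightarrow> t \<in> {1..k} \<Longrightarrow> f (uv_sigma n k i t) = s i t"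
    by (rule hom_from_UV[OF H.is_group H.r_closed H.s_closed H.uv_relations]) (auto intro: that)
  interpret f: group_hom "UV n k" H f
    by (intro group_hom.intro group_hom_axioms.intro group_UV H.is_group f)
  have "map_prod f f ` mvb_relations n k (UV n k) (uv_sigma n k) = mvb_relations n k H s"
    by (rule f.mvb_relations_image[OF k]) (simp_all add: uv_sigma_closed fs)
  then have rel_f: "map_prod f f ` mvb_relations n k (UV n k) (uv_sigma n k) \<subseteq> Id"
    using H.mvb_relations by simp
  have rel_closed: "mvb_relations n k (UV n k) (uv_sigma n k) \<subseteq> carrier (UV n k) \<times> carrier (UV n k)"
    by (intro mvb_relations_closed group_UV k uv_sigma_closed)
  obtain g where g: "g \<in> hom (MVB n k) H"
    and gf: "\<And>x. x \<in> carrier (UV n k) \<Longrightarrow> g (mvb_quot n k x) = f x"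
    by (rule f.hom_from_relation_quotient[OF rel_closed rel_f,
          folded MVB_kernel_def, folded MVB_def mvb_quot_def]) (rule that)
  interpret g: group_hom "MVB n k" H g
    by (intro group_hom.intro group_hom_axioms.intro q.H.is_group H.is_group g)
  have "map_prod f f ` R \<subseteq> Id"
    by (rule kill[OF f.group_hom_axioms fr fs])
  then have "map_prod g g ` (map_prod (mvb_quot n k) (mvb_quot n k) ` R) \<subseteq> Id"
    using R by (force simp: gf)
  then obtain h where h: "h \<in> hom (MVB_quotient n k R) H"
    and hg: "\<And>y. y \<in> carrier (MVB n k) \<Longrightarrow> h (relation_closure (MVB n k)
        (map_prod (mvb_quot n k) (mvb_quot n k) ` R) #>\<^bsub>MVB n k\<^esub> y) = g y"
    by (rule g.hom_from_relation_quotient[OF mvb_quot_relations_closed, folded MVB_quotient_def])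
      (auto intro: that)
  show thesis
    by (rule that[OF h])
      (simp_all add: MVB_quotient_proj_def hg gf fr fs uv_rho_closed uv_sigma_closed)
qed

text \<open>The images of the \<open>\<rho>\<^sub>i\<close> and \<open>\<sigma>\<^sub>i\<^sub>,\<^sub>t\<close> generate the quotient.\<close>

lemma MVB_quotient_hom_eqI:
  assumes H: "group H" and f: "f \<in> hom (MVB_quotient n k R) H" and g: "g \<in> hom (MVB_quotient n k R) H"
    and r: "\<And>i. i \<in> {1..n-1} \<Longrightarrow>
      f (MVB_quotient_proj n k R (uv_rho n k i)) = g (MVB_quotient_proj n k R (uv_rho n k i))"
    and s: "\<And>i t. i \<in> {1..n-1} \<Longrightarrow> t \<in> {1..k} \<Longrightarrow>
      f (MVB_quotient_proj n k R (uv_sigma n k i t)) = g (MVB_quotient_proj n k R (uv_sigma n k i t))"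
    and x: "x \<in> carrier (MVB_quotient n k R)"
  shows "f x = g x"
proof -
  let ?p = "MVB_quotient_proj n k R"
  from x obtain y where y: "y \<in> carrier (UV n k)" "x = ?p y"
    by (auto simp: MVB_quotient_def MVB_quotient_proj_def MVB_def mvb_quot_def carrier_FactGroup)
  have "(f \<circ> ?p) y = (g \<circ> ?p) y"
    by (rule UV_hom_eqI[OF H hom_compose[OF p.homh f] hom_compose[OF p.homh g]])
      (simp_all add: r s y)
  then show ?thesis using y by simp
qed

end

section \<open>Reversing the strands\<close>

text \<open>Conjugation by \<open>a \<otimes> b\<close> takes \<open>x\<close> to \<open>y\<close>; as \<open>b \<otimes> a\<close> is the inverse of \<open>a \<otimes> b\<close>, conjugation
  by it takes \<open>y\<close> back to \<open>x\<close>.\<close>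

lemma (in group) mixed_relation_reverse:
  assumes c: "a \<in> carrier G" "b \<in> carrier G" "x \<in> carrier G" "y \<in> carrier G"
    and inv: "a \<otimes> a = \<one>" "b \<otimes> b = \<one>"
    and rel: "a \<otimes> b \<otimes> x = y \<otimes> a \<otimes> b"
  shows "b \<otimes> a \<otimes> y = x \<otimes> b \<otimes> a"
proof -
  have ab: "b \<otimes> a \<otimes> (a \<otimes> b) = \<one>" "a \<otimes> b \<otimes> (b \<otimes> a) = \<one>"
    using c inv by (metis m_assoc m_closed r_one)+
  have "b \<otimes> a \<otimes> y = b \<otimes> a \<otimes> (y \<otimes> a \<otimes> b) \<otimes> (b \<otimes> a)"
    using c ab by (simp add: m_assoc)
  also have "\<dots> = b \<otimes> a \<otimes> (a \<otimes> b \<otimes> x) \<otimes> (b \<otimes> a)" by (simp add: rel)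
  also have "\<dots> = (b \<otimes> a \<otimes> (a \<otimes> b)) \<otimes> (x \<otimes> b \<otimes> a)" using c by (simp add: m_assoc)
  finally show ?thesis using c ab by simp
qed

context multi_virtual_family
begin

text \<open>Rewriting with these equations turns a relation between reversed neighbours into one between
  the original neighbours \<open>j + 1\<close> and \<open>j\<close>.\<close>

lemma reverse_pair:
  assumes "i \<in> {1..n-2}"
  obtains j where "j \<in> {1..n-2}" "n - i = j + 1" "n - (i + 1) = j"
    "j \<in> {1..n-1}" "j + 1 \<in> {1..n-1}"
  using assms by (intro that[of "n - (i + 1)"]) auto

text \<open>The relations between single or distant generators only need that reversal preserves the index
  range and distances; the braid relations come back with their two sides exchanged; the mixed
  relation needs \<open>mixed_relation_reverse\<close>.\<close>

lemma reverse: "multi_virtual_family G n k (\<lambda>i. r (n - i)) (\<lambda>i. s (n - i))"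
proof
  have idx: "n - i \<in> {1..n-1}" if "i \<in> {1..n-1}" for i using that by auto
  have far: "far (n - i) (n - j)" if "far i j" "i \<in> {1..n-1}" "j \<in> {1..n-1}" for i j
    using that by (auto simp: far_def)
  have uvD: "u = v" if "(u, v) \<in> uv_relations n k G r s" for u v
    using uv_relations that by blast
  have mvbD: "u = v" if "(u, v) \<in> mvb_relations n k G s" for u v
    using mvb_relations that by blast
  have uv:
    "\<And>i. i \<in> {1..n-1} \<Longrightarrow> r i \<otimes> r i = \<one>"
    "\<And>i. i \<in> {1..n-2} \<Longrightarrow> r i \<otimes> r (i+1) \<otimes> r i = r (i+1) \<otimes> r i \<otimes> r (i+1)"
    "\<And>i j. i \<in> {1..n-1} \<Longrightarrow> j \<in> {1..n-1} \<Longrightarrow> far i j \<Longrightarrow> r i \<otimes> r j = r j \<otimes> r i"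
    "\<And>i j t l. i \<in> {1..n-1} \<Longrightarrow> j \<in> {1..n-1} \<Longrightarrow> far i j \<Longrightarrow> t \<in> {1..k} \<Longrightarrow> l \<in> {1..k}
      \<Longrightarrow> s i t \<otimes> s j l = s j l \<otimes> s i t"
    "\<And>i j t. i \<in> {1..n-1} \<Longrightarrow> j \<in> {1..n-1} \<Longrightarrow> far i j \<Longrightarrow> t \<in> {1..k}
      \<Longrightarrow> s i t \<otimes> r j = r j \<otimes> s i t"
    "\<And>i t. i \<in> {1..n-2} \<Longrightarrow> t \<in> {1..k}
      \<Longrightarrow> r i \<otimes> r (i+1) \<otimes> s i t = s (i+1) t \<otimes> r i \<otimes> r (i+1)"
    by (rule uvD, unfold uv_relations_def, blast)+
  have mvb:
    "\<And>i t. i \<in> {1..n-1} \<Longrightarrow> t \<in> {1..k-1} \<Longrightarrow> s i t \<otimes> s i t = \<one>"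
    "\<And>i t. i \<in> {1..n-2} \<Longrightarrow> t \<in> {1..k-1}
      \<Longrightarrow> s i t \<otimes> s (i+1) t \<otimes> s i t = s (i+1) t \<otimes> s i t \<otimes> s (i+1) t"
    "\<And>i. i \<in> {1..n-2} \<Longrightarrow> s i k \<otimes> s (i+1) k \<otimes> s i k = s (i+1) k \<otimes> s i k \<otimes> s (i+1) k"
    by (rule mvbD, unfold mvb_relations_def, blast)+
  show "1 \<le> k" by (rule k)
  show "r (n - i) \<in> carrier G" if "i \<in> {1..n-1}" for i
    by (intro r_closed idx that)
  show "s (n - i) t \<in> carrier G" if "i \<in> {1..n-1}" "t \<in> {1..k}" for i t
    by (intro s_closed idx that)
  have braid: "r (n - i) \<otimes> r (n - (i+1)) \<otimes> r (n - i) = r (n - (i+1)) \<otimes> r (n - i) \<otimes> r (n - (i+1))"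
    if "i \<in> {1..n-2}" for i
    by (rule reverse_pair[OF that]) (simp only: uv(2))
  have mixed: "r (n - i) \<otimes> r (n - (i+1)) \<otimes> s (n - i) t = s (n - (i+1)) t \<otimes> r (n - i) \<otimes> r (n - (i+1))"
    if i: "i \<in> {1..n-2}" and t: "t \<in> {1..k}" for i t
  proof -
    obtain j where j: "j \<in> {1..n-2}" "n - i = j + 1" "n - (i + 1) = j"
      and j': "j \<in> {1..n-1}" "j + 1 \<in> {1..n-1}"
      using reverse_pair[OF i] .
    show ?thesis
      unfolding j
      by (rule mixed_relation_reverse) (use j j' t in \<open>simp_all only: r_closed s_closed uv(1,6)\<close>)
  qed
  show "uv_relations n k G (\<lambda>i. r (n - i)) (\<lambda>i. s (n - i)) \<subseteq> Id"
    unfolding uv_relations_def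
    by (intro Un_least; clarify; intro IdI uv(1,3-5) idx far braid mixed; assumption)
  have braid': "s (n - i) t \<otimes> s (n - (i+1)) t \<otimes> s (n - i) t
      = s (n - (i+1)) t \<otimes> s (n - i) t \<otimes> s (n - (i+1)) t"
    if "i \<in> {1..n-2}" "t \<in> {1..k-1}" for i t
    by (rule reverse_pair[OF that(1)]) (simp only: mvb(2) that(2))
  have braid_k: "s (n - i) k \<otimes> s (n - (i+1)) k \<otimes> s (n - i) k
      = s (n - (i+1)) k \<otimes> s (n - i) k \<otimes> s (n - (i+1)) k"
    if "i \<in> {1..n-2}" for i
    by (rule reverse_pair[OF that(1)]) (simp only: mvb(3))
  show "mvb_relations n k G (\<lambda>i. s (n - i)) \<subseteq> Id"
    unfolding mvb_relations_def
    by (intro Un_least; clarify; intro IdI mvb(1) idx braid' braid_k; assumption)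
qed

text \<open>With \<open>j = n - (i + 1)\<close>, the relation F1 at \<open>j\<close> reads, in terms of the reversed family, as the
  relation F2 at \<open>i\<close>, and conversely.\<close>

lemma reverse_forbidden:
  "F1_relations n k G r s \<subseteq> Id
    \<Longrightarrow> F2_relations n k G (\<lambda>i. r (n - i)) (\<lambda>i. s (n - i)) \<subseteq> Id"
  "F2_relations n k G r s \<subseteq> Id
    \<Longrightarrow> F1_relations n k G (\<lambda>i. r (n - i)) (\<lambda>i. s (n - i)) \<subseteq> Id"
proof -
  assume "F1_relations n k G r s \<subseteq> Id"
  then have F: "r i \<otimes> s (i+1) t \<otimes> s i t = s (i+1) t \<otimes> s i t \<otimes> r (i+1)"
    if "i \<in> {1..n-2}" "t \<in> {1..k}" for i t
    using that unfolding F1_relations_def by blast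
  have "r (n - (i+1)) \<otimes> s (n - i) t \<otimes> s (n - (i+1)) t = s (n - i) t \<otimes> s (n - (i+1)) t \<otimes> r (n - i)"
    if "i \<in> {1..n-2}" "t \<in> {1..k}" for i t
    by (rule reverse_pair[OF that(1)]) (simp only: F that(2))
  then show "F2_relations n k G (\<lambda>i. r (n - i)) (\<lambda>i. s (n - i)) \<subseteq> Id"
    unfolding F2_relations_def by blast
next
  assume "F2_relations n k G r s \<subseteq> Id"
  then have F: "r (i+1) \<otimes> s i t \<otimes> s (i+1) t = s i t \<otimes> s (i+1) t \<otimes> r i"
    if "i \<in> {1..n-2}" "t \<in> {1..k}" for i t
    using that unfolding F2_relations_def by blast
  have "r (n - i) \<otimes> s (n - (i+1)) t \<otimes> s (n - i) t = s (n - (i+1)) t \<otimes> s (n - i) t \<otimes> r (n - (i+1))"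
    if "i \<in> {1..n-2}" "t \<in> {1..k}" for i t
    by (rule reverse_pair[OF that(1)]) (simp only: F that(2))
  then show "F1_relations n k G (\<lambda>i. r (n - i)) (\<lambda>i. s (n - i)) \<subseteq> Id"
    unfolding F1_relations_def by blast
qed

end

lemma forbidden_relations_transfer:
  assumes "group_hom (UV n k) H h"
    and "\<And>i. i \<in> {1..n-1} \<Longrightarrow> h (uv_rho n k i) = r i"
    and "\<And>i t. i \<in> {1..n-1} \<Longrightarrow> t \<in> {1..k} \<Longrightarrow> h (uv_sigma n k i t) = s i t"
  shows "map_prod h h ` UV_F1 n k = F1_relations n k H r s"
    and "map_prod h h ` UV_F2 n k = F2_relations n k H r s"
  unfolding UV_F1_def UV_F2_def
  by (intro group_hom.forbidden_relations_image[OF assms(1)] uv_rho_closed uv_sigma_closed assms(2,3);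
      assumption)+

lemma MVB_quotient_forbidden:
  assumes k: "k \<ge> 1"
  shows "F1_relations n k (MVB_quotient n k (UV_F1 n k))
      (\<lambda>i. MVB_quotient_proj n k (UV_F1 n k) (uv_rho n k i))
      (\<lambda>i t. MVB_quotient_proj n k (UV_F1 n k) (uv_sigma n k i t)) \<subseteq> Id"
    and "F2_relations n k (MVB_quotient n k (UV_F2 n k))
      (\<lambda>i. MVB_quotient_proj n k (UV_F2 n k) (uv_rho n k i))
      (\<lambda>i t. MVB_quotient_proj n k (UV_F2 n k) (uv_sigma n k i t)) \<subseteq> Id"
  using MVB_quotient_satisfies[OF k UV_F_closed(1)] MVB_quotient_satisfies[OF k UV_F_closed(2)]
  unfolding forbidden_relations_transfer(1)[OF group_hom_MVB_quotient_proj[OF k UV_F_closed(1)] HOL.refl HOL.refl]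
    forbidden_relations_transfer(2)[OF group_hom_MVB_quotient_proj[OF k UV_F_closed(2)] HOL.refl HOL.refl] .

theorem corollary3p2:
  fixes n k :: nat
  assumes "k \<ge> 1" and "n \<ge> 3"
  shows "MVB n k Mod relation_closure (MVB n k) (map_prod (mvb_quot n k) (mvb_quot n k) ` UV_F1 n k)
       \<cong> MVB n k Mod relation_closure (MVB n k) (map_prod (mvb_quot n k) (mvb_quot n k) ` UV_F2 n k)"
proof -
  note k = \<open>k \<ge> 1\<close>
  let ?Q1 = "MVB_quotient n k (UV_F1 n k)" and ?Q2 = "MVB_quotient n k (UV_F2 n k)"
  let ?p1 = "MVB_quotient_proj n k (UV_F1 n k)" and ?p2 = "MVB_quotient_proj n k (UV_F2 n k)"
  note closed = UV_F_closed[of n k]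
  interpret Q1: multi_virtual_family ?Q1 n k "\<lambda>i. ?p1 (uv_rho n k i)" "\<lambda>i t. ?p1 (uv_sigma n k i t)"
    by (rule MVB_quotient_family[OF k closed(1)])
  interpret Q2: multi_virtual_family ?Q2 n k "\<lambda>i. ?p2 (uv_rho n k i)" "\<lambda>i t. ?p2 (uv_sigma n k i t)"
    by (rule MVB_quotient_family[OF k closed(2)])
  obtain f where f: "f \<in> hom ?Q1 ?Q2"
    and fr: "\<And>i. i \<in> {1..n-1} \<Longrightarrow> f (?p1 (uv_rho n k i)) = ?p2 (uv_rho n k (n - i))"
    and fs: "\<And>i t. i \<in> {1..n-1} \<Longrightarrow> t \<in> {1..k}
      \<Longrightarrow> f (?p1 (uv_sigma n k i t)) = ?p2 (uv_sigma n k (n - i) t)"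
  proof (rule hom_from_MVB_quotient[OF k closed(1) Q2.reverse])
    fix h assume "group_hom (UV n k) ?Q2 h"
      and "\<And>i. i \<in> {1..n-1} \<Longrightarrow> h (uv_rho n k i) = ?p2 (uv_rho n k (n - i))"
      and "\<And>i t. i \<in> {1..n-1} \<Longrightarrow> t \<in> {1..k} \<Longrightarrow> h (uv_sigma n k i t) = ?p2 (uv_sigma n k (n - i) t)"
    from forbidden_relations_transfer(1)[OF this]
    show "map_prod h h ` UV_F1 n k \<subseteq> Id"
      using Q2.reverse_forbidden(2)[OF MVB_quotient_forbidden(2)[OF k]] by (rule ord_eq_le_trans)
  qed (rule that)
  obtain g where g: "g \<in> hom ?Q2 ?Q1"
    and gr: "\<And>i. i \<in> {1..n-1} \<Longrightarrow> g (?p2 (uv_rho n k i)) = ?p1 (uv_rho n k (n - i))"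
    and gs: "\<And>i t. i \<in> {1..n-1} \<Longrightarrow> t \<in> {1..k}
      \<Longrightarrow> g (?p2 (uv_sigma n k i t)) = ?p1 (uv_sigma n k (n - i) t)"
  proof (rule hom_from_MVB_quotient[OF k closed(2) Q1.reverse])
    fix h assume "group_hom (UV n k) ?Q1 h"
      and "\<And>i. i \<in> {1..n-1} \<Longrightarrow> h (uv_rho n k i) = ?p1 (uv_rho n k (n - i))"
      and "\<And>i t. i \<in> {1..n-1} \<Longrightarrow> t \<in> {1..k} \<Longrightarrow> h (uv_sigma n k i t) = ?p1 (uv_sigma n k (n - i) t)"
    from forbidden_relations_transfer(2)[OF this]
    show "map_prod h h ` UV_F2 n k \<subseteq> Id"
      using Q1.reverse_forbidden(1)[OF MVB_quotient_forbidden(1)[OF k]] by (rule ord_eq_le_trans)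
  qed (rule that)
  have idx: "n - i \<in> {1..n-1}" "n - (n - i) = i" if "i \<in> {1..n-1}" for i
    using that by auto
  \<comment> \<open>On generators the composites replace the index \<open>i\<close> by \<open>n - (n - i)\<close>.\<close>
  have gf: "g (f x) = x" if "x \<in> carrier ?Q1" for x
  proof -
    have "(g \<circ> f) x = (\<lambda>y. y) x"
      by (rule MVB_quotient_hom_eqI[OF k closed(1) Q1.is_group hom_compose[OF f g]
            iso_imp_homomorphism[OF iso_set_refl] _ _ that])
        (simp_all only: comp_apply fr fs gr gs idx)
    then show ?thesis by simp
  qed
  have fg: "f (g x) = x" if "x \<in> carrier ?Q2" for x
  proof -
    have "(f \<circ> g) x = (\<lambda>y. y) x"
      by (rule MVB_quotient_hom_eqI[OF k closed(2) Q2.is_group hom_compose[OF g f]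
            iso_imp_homomorphism[OF iso_set_refl] _ _ that])
        (simp_all only: comp_apply fr fs gr gs idx)
    then show ?thesis by simp
  qed
  have "bij_betw f (carrier ?Q1) (carrier ?Q2)"
    by (rule bij_betw_byWitness[where f' = g]) (use f g gf fg in \<open>auto simp: hom_def\<close>)
  then have "?Q1 \<cong> ?Q2" using f by (intro is_isoI isoI)
  then show ?thesis by (simp add: MVB_quotient_def)
qed

end
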